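(* Let $f\in\mathcal C^2(\mathbb R^n)$ be globally bounded below by $f^*$, with gradient satisfying $\|\nabla f(x)-\nabla f(y)\|\le L\|x-y\|$ and Hessian $H$ satisfying $\|H(x)-H(y)\|\le L_H\|x-y\|$ for all $x,y\in\mathbb R^n$ and some $L,L_H>0$. Let the sequence of random models and corresponding steps generated in the ARC algorithm described in the context be $(p)$-probabilistically sufficiently accurate, with constants $\kappa_g,\kappa_H$ and with $p>1/2$. Then the expected number of iterations $N_\epsilon$ that the algorithm takes until $\|\nabla f(X^{k+1})\|\le\epsilon$ occurs is bounded by $$\mathbb E(N_\epsilon)\le\frac{2p}{(2p-1)^2}\left(\frac{M}{\epsilon^{3/2}}+\log\left(\frac{2\kappa_g+\kappa_H+L+L_H}{\sigma_0(1-\frac13\theta)}\right)\right),$$ where $M=\frac{(f(x^0)-f^* )(2\kappa_g+\kappa_H+L+L_H)^{3/2}}{\kappa_f(1-\frac13\theta)^{3/2}}$, with $\kappa_f=\frac{\theta}{12\sqrt2}(1-\kappa_\theta)^{3/2}\sigma_{\min}$, is a constant independent of $p$ and $\epsilon$.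
   Context: ARC (adaptive regularization with cubics) algorithm with random models. Parameters $\gamma\in(0,1)$, $\theta\in(0,1)$, $\sigma_{\min}>0$, $\kappa_\theta\in(0,1)$; initial $x^0\in\mathbb R^n$, $\sigma_0>\sigma_{\min}$. At iteration $k=0,1,\dots$: compute a (random) approximate gradient $g^k$ and approximate Hessian matrix $b^k$ and form $m_k(x^k+s)=f(x^k)+s^Tg^k+\frac12s^Tb^ks+\frac{\sigma_k}{3}\|s\|^3$. Compute a trial step $s^k$ satisfying $(s^k)^Tg^k+(s^k)^Tb^ks^k+\sigma_k\|s^k\|^3=0$, $(s^k)^Tb^ks^k+\sigma_k\|s^k\|^3\ge0$, and $\|\nabla m_k(x^k+s^k)\|\le\kappa_\theta\min\{1,\|s^k\|\}\|g^k\|$. Compute $\rho_k=\frac{f(x^k)-f(x^k+s^k)}{f(x^k)-m_k(x^k+s^k)}$. If $\rho_k\ge\theta$ (successful), set $x^{k+1}=x^k+s^k$ and $\sigma_{k+1}=\max\{\gamma\sigma_k,\sigma_{\min}\}$; otherwise (unsuccessful), set $x^{k+1}=x^k$ and $\sigma_{k+1}=\sigma_k/\gamma$. Capital letters $M_k,G^k,B^k,S^k,X^k,\Sigma_k$ denote the random variables with realizations $m_k,g^k,b^k,s^k,x^k,\sigma_k$. The models are $(p)$-probabilistically sufficiently accurate if there exist constants $\kappa_g,\kappa_H$ such that the indicators $I_k=\mathbb 1\{\|\nabla f(X^k)-G^k\|\le\kappa_g\|S^k\|^2\ \text{and}\ \|(H(X^k)-B^k)S^k\|\le\kappa_H\|S^k\|^2\}$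 satisfy $P(I_k=1\mid\mathcal F^M_{k-1})\ge p$, where $\mathcal F^M_{k-1}=\sigma(M_0,\dots,M_{k-1})$. $N_\epsilon$ denotes the (random) index $k$ of the first successful iteration resulting in $\|\nabla f(X^{k+1})\|\le\epsilon$. In the underlying general analysis, with $\mathcal A_k=1/\Sigma_k$, $\alpha_0=1/\sigma_0$, $\alpha_{\max}=1/\sigma_{\min}$ and $C=\frac{1-\frac13\theta}{2\kappa_g+\kappa_H+L+L_H}$ (true iterations, i.e. those with $I_k=1$, with $\mathcal A_k\le C$ are successful), it is assumed, without loss of generality, that $C=\gamma^c\alpha_0<\gamma\alpha_{\max}$ for some positive integer $c$.
   Formalization: The logarithm is taken to base 1/γ (with the natural logarithm the bound fails as γ→1); b^k is symmetric; ρ_k = 0/0, possible only when s^k = 0, counts as successful; each step S^k is determined by the models up to iteration k. *)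

theory Defs
  imports "HOL-Probability.Probability"
begin

definition gradient :: "('a::real_inner \<Rightarrow> real) \<Rightarrow> 'a \<Rightarrow> 'a" where
  "gradient f x = (THE d. GDERIV f x :> d)"

definition hessian :: "(real^'n \<Rightarrow> real) \<Rightarrow> real^'n \<Rightarrow> real^'n^'n" where
  "hessian f x = jacobian (gradient f) (at x)"

definition C2_function :: "(real^'n \<Rightarrow> real) \<Rightarrow> bool" where
  "C2_function f \<longleftrightarrow>
     (\<forall>x. f differentiable (at x)) \<and>
     (\<forall>x. gradient f differentiable (at x)) \<and>
     continuous_on UNIV (hessian f)"

text \<open>The model is a function of the point \<open>y = x + s\<close>, not of the step \<open>s\<close>.\<close>

definition cubic_model ::
  "(real^'n \<Rightarrow> real) \<Rightarrow> real^'n \<Rightarrow> real \<Rightarrow> real^'n \<Rightarrow> real^'n^'n \<Rightarrow> real^'n \<Rightarrow> real" where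
  "cubic_model f x \<sigma> g b y =
     f x + (y - x) \<bullet> g + 1/2 * ((y - x) \<bullet> (b *v (y - x))) + \<sigma> / 3 * norm (y - x) ^ 3"

definition trial_step ::
  "(real^'n \<Rightarrow> real) \<Rightarrow> real \<Rightarrow> real^'n \<Rightarrow> real \<Rightarrow> real^'n \<Rightarrow> real^'n^'n \<Rightarrow> real^'n \<Rightarrow> bool" where
  "trial_step f \<kappa>\<theta> x \<sigma> g b s \<longleftrightarrow>
     s \<bullet> g + s \<bullet> (b *v s) + \<sigma> * norm s ^ 3 = 0 \<and>
     s \<bullet> (b *v s) + \<sigma> * norm s ^ 3 \<ge> 0 \<and>
     norm (gradient (cubic_model f x \<sigma> g b) (x + s)) \<le> \<kappa>\<theta> * min 1 (norm s) * norm g"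

text \<open>For \<open>\<sigma> > 0\<close> and a trial step \<open>s\<close>, the predicted decrease is at least
  \<open>\<sigma> / 6 * norm s ^ 3\<close>. So it vanishes only if \<open>s = 0\<close>, when the actual decrease vanishes as
  well; the undefined quotient 0/0 is read as 1 (perfect agreement).\<close>

definition decrease_ratio ::
  "(real^'n \<Rightarrow> real) \<Rightarrow> real^'n \<Rightarrow> real \<Rightarrow> real^'n \<Rightarrow> real^'n^'n \<Rightarrow> real^'n \<Rightarrow> real" where
  "decrease_ratio f x \<sigma> g b s =
     (if f x - cubic_model f x \<sigma> g b (x + s) = 0 then 1
      else (f x - f (x + s)) / (f x - cubic_model f x \<sigma> g b (x + s)))"

definition successful ::
  "(real^'n \<Rightarrow> real) \<Rightarrow> real \<Rightarrow> real^'n \<Rightarrow> real \<Rightarrow> real^'n \<Rightarrow> real^'n^'n \<Rightarrow> real^'n \<Rightarrow> bool" where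
  "successful f \<theta> x \<sigma> g b s \<longleftrightarrow> decrease_ratio f x \<sigma> g b s \<ge> \<theta>"

text \<open>An approximate Hessian is taken to be a symmetric matrix; without symmetry the gradient of the
  cubic model would not be \<open>g + b *v s + (\<sigma> * norm s) *R s\<close>.\<close>

definition arc_run ::
  "(real^'n \<Rightarrow> real) \<Rightarrow> real \<Rightarrow> real \<Rightarrow> real \<Rightarrow> real \<Rightarrow> real^'n \<Rightarrow> real \<Rightarrow>
   (nat \<Rightarrow> real^'n) \<Rightarrow> (nat \<Rightarrow> real) \<Rightarrow> (nat \<Rightarrow> real^'n) \<Rightarrow> (nat \<Rightarrow> real^'n^'n) \<Rightarrow> (nat \<Rightarrow> real^'n) \<Rightarrow> bool"
where
  "arc_run f \<gamma> \<theta> \<sigma>min \<kappa>\<theta> x0 \<sigma>0 x \<sigma> g b s \<longleftrightarrow>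
     x 0 = x0 \<and> \<sigma> 0 = \<sigma>0 \<and>
     (\<forall>k. transpose (b k) = b k \<and>
          trial_step f \<kappa>\<theta> (x k) (\<sigma> k) (g k) (b k) (s k) \<and>
          (if successful f \<theta> (x k) (\<sigma> k) (g k) (b k) (s k)
           then x (Suc k) = x k + s k \<and> \<sigma> (Suc k) = max (\<gamma> * \<sigma> k) \<sigma>min
           else x (Suc k) = x k \<and> \<sigma> (Suc k) = \<sigma> k / \<gamma>))"

text \<open>The infimum of the empty set is \<open>\<infinity>\<close>: the value if the event never occurs.\<close>

definition N_eps ::
  "(real^'n \<Rightarrow> real) \<Rightarrow> real \<Rightarrow> real \<Rightarrow>
   (nat \<Rightarrow> real^'n) \<Rightarrow> (nat \<Rightarrow> real) \<Rightarrow> (nat \<Rightarrow> real^'n) \<Rightarrow> (nat \<Rightarrow> real^'n^'n) \<Rightarrow> (nat \<Rightarrow> real^'n) \<Rightarrow> enat"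
where
  "N_eps f \<theta> \<epsilon> x \<sigma> g b s =
     Inf (enat ` {k. successful f \<theta> (x k) (\<sigma> k) (g k) (b k) (s k) \<and>
                     norm (gradient f (x (Suc k))) \<le> \<epsilon>})"

text \<open>The model \<open>M\<^sub>k\<close> is identified with its data \<open>(X\<^sub>k, \<Sigma>\<^sub>k, G\<^sub>k, B\<^sub>k)\<close>. The \<open>\<sigma>\<close>-algebra
  \<open>model_history \<dots> k\<close> is generated by \<open>M\<^sub>0, \<dots>, M\<^sub>k\<^sub>-\<^sub>1\<close>, hence trivial for \<open>k = 0\<close>.\<close>

definition model_history ::
  "'w measure \<Rightarrow> (nat \<Rightarrow> 'w \<Rightarrow> real^'n) \<Rightarrow> (nat \<Rightarrow> 'w \<Rightarrow> real) \<Rightarrow>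
   (nat \<Rightarrow> 'w \<Rightarrow> real^'n) \<Rightarrow> (nat \<Rightarrow> 'w \<Rightarrow> real^'n^'n) \<Rightarrow> nat \<Rightarrow> 'w measure" where
  "model_history P X \<Sigma> G B k =
     sigma (space P)
       {(\<lambda>\<omega>. (X j \<omega>, \<Sigma> j \<omega>, G j \<omega>, B j \<omega>)) -` A \<inter> space P | j A. j < k \<and> A \<in> sets borel}"

text \<open>Each step is computed from the models up to the current
  one, which is the measurability condition on \<open>S k\<close>.\<close>

definition arc_process ::
  "'w measure \<Rightarrow> (real^'n \<Rightarrow> real) \<Rightarrow> real \<Rightarrow> real \<Rightarrow> real \<Rightarrow> real \<Rightarrow> real^'n \<Rightarrow> real \<Rightarrow>
   (nat \<Rightarrow> 'w \<Rightarrow> real^'n) \<Rightarrow> (nat \<Rightarrow> 'w \<Rightarrow> real) \<Rightarrow> (nat \<Rightarrow> 'w \<Rightarrow> real^'n) \<Rightarrow>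
   (nat \<Rightarrow> 'w \<Rightarrow> real^'n^'n) \<Rightarrow> (nat \<Rightarrow> 'w \<Rightarrow> real^'n) \<Rightarrow> bool" where
  "arc_process P f \<gamma> \<theta> \<sigma>min \<kappa>\<theta> x0 \<sigma>0 X \<Sigma> G B S \<longleftrightarrow>
     prob_space P \<and>
     (\<forall>k. G k \<in> borel_measurable P \<and> B k \<in> borel_measurable P \<and>
          S k \<in> borel_measurable (model_history P X \<Sigma> G B (Suc k))) \<and>
     (\<forall>\<omega>\<in>space P. arc_run f \<gamma> \<theta> \<sigma>min \<kappa>\<theta> x0 \<sigma>0
        (\<lambda>k. X k \<omega>) (\<lambda>k. \<Sigma> k \<omega>) (\<lambda>k. G k \<omega>) (\<lambda>k. B k \<omega>) (\<lambda>k. S k \<omega>))"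

definition accurate_model ::
  "(real^'n \<Rightarrow> real) \<Rightarrow> real \<Rightarrow> real \<Rightarrow> real^'n \<Rightarrow> real^'n \<Rightarrow> real^'n^'n \<Rightarrow> real^'n \<Rightarrow> bool" where
  "accurate_model f \<kappa>g \<kappa>H x g b s \<longleftrightarrow>
     norm (gradient f x - g) \<le> \<kappa>g * (norm s)\<^sup>2 \<and>
     norm ((hessian f x - b) *v s) \<le> \<kappa>H * (norm s)\<^sup>2"

definition prob_sufficiently_accurate ::
  "'w measure \<Rightarrow> (real^'n \<Rightarrow> real) \<Rightarrow> real \<Rightarrow> real \<Rightarrow> real \<Rightarrow>
   (nat \<Rightarrow> 'w \<Rightarrow> real^'n) \<Rightarrow> (nat \<Rightarrow> 'w \<Rightarrow> real) \<Rightarrow> (nat \<Rightarrow> 'w \<Rightarrow> real^'n) \<Rightarrow>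
   (nat \<Rightarrow> 'w \<Rightarrow> real^'n^'n) \<Rightarrow> (nat \<Rightarrow> 'w \<Rightarrow> real^'n) \<Rightarrow> bool" where
  "prob_sufficiently_accurate P f p \<kappa>g \<kappa>H X \<Sigma> G B S \<longleftrightarrow>
     (\<forall>k. AE \<omega> in P.
        real_cond_exp P (model_history P X \<Sigma> G B k)
          (indicator {\<omega> \<in> space P. accurate_model f \<kappa>g \<kappa>H (X k \<omega>) (G k \<omega>) (B k \<omega>) (S k \<omega>)}) \<omega> \<ge> p)"

end

theory Submission
  imports Defs
begin

text \<open>Let \<open>\<sigma>C = 1 / C\<close> and let \<open>level \<sigma>\<close> be \<open>log (1 / \<gamma>) (\<sigma>C / \<sigma>)\<close> rounded up. Before the run stops,
  the potential \<open>\<Psi> = 2 (f x - f\<^sup>*) / h(C) + \<bar>level \<sigma>\<bar>\<close> drops by at least 1 in every accurate iteration: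
  at levels \<open>\<le> 0\<close> the step succeeds, which brings the level back towards 0, at levels \<open>\<ge> 0\<close> a
  successful step decreases \<open>f\<close> by at least \<open>h(C)\<close>, and an unsuccessful one lowers a positive level.
  In an inaccurate iteration \<open>\<Psi>\<close> grows by at most 1. Hence, on every path, accurate iterations up
  to stopping outnumber the inaccurate ones by at most \<open>\<Psi>\<^sub>0 + 1\<close>. Not having stopped before \<open>k\<close> is an
  event of the history of iteration \<open>k\<close>, so taking expectations yields
  \<open>(2 p - 1) E(N\<^sub>\<epsilon> + 1) \<le> \<Psi>\<^sub>0 + 1\<close>, where \<open>\<Psi>\<^sub>0 = 2 (f x0 - f\<^sup>*) / h(C) + c\<close>.\<close>

section \<open>Derivatives and Taylor bounds\<close>

lemma gradient_eqI: "GDERIV f x :> d \<Longrightarrow> gradient f x = d"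
proof -
  have unique: "e = d" if "GDERIV f x :> d" "GDERIV f x :> e" for d e
  proof -
    have "(\<lambda>h. h \<bullet> d) = (\<lambda>h. h \<bullet> e)"
      using that unfolding gderiv_def by (rule has_derivative_unique)
    then have "(e - d) \<bullet> (e - d) = 0"
      by (metis inner_diff_right right_minus_eq)
    then show ?thesis by simp
  qed
  assume "GDERIV f x :> d"
  then show ?thesis
    unfolding gradient_def using unique by blast
qed

text \<open>Riesz representation in coordinates: the gradient has the components
  \<open>f' i\<close>.\<close>

lemma GDERIV_gradient:
  fixes f :: "'a::euclidean_space \<Rightarrow> real"
  assumes "f differentiable (at x)"
  shows "GDERIV f x :> gradient f x"
proof -
  obtain f' where f': "(f has_derivative f') (at x)"
    using assms by (auto simp: differentiable_def)
  then have lin: "linear f'"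
    by (rule has_derivative_linear)
  have "f' h = h \<bullet> (\<Sum>i\<in>Basis. f' i *\<^sub>R i)" for h
  proof -
    have "f' h = f' (\<Sum>i\<in>Basis. (h \<bullet> i) *\<^sub>R i)"
      by (simp add: euclidean_representation)
    also have "\<dots> = (\<Sum>i\<in>Basis. (h \<bullet> i) * f' i)"
      using lin by (simp add: linear_sum linear_cmul)
    finally show ?thesis
      by (simp add: inner_sum_right mult.commute)
  qed
  then have "f' = (\<lambda>h. h \<bullet> (\<Sum>i\<in>Basis. f' i *\<^sub>R i))" by blast
  then have "GDERIV f x :> (\<Sum>i\<in>Basis. f' i *\<^sub>R i)"
    unfolding gderiv_def using f' by simp
  then show ?thesis
    using gradient_eqI by metis
qed

text \<open>The norm is not differentiable at 0, so the chain rule covers only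
  \<open>x \<noteq> 0\<close>; at 0 the error quotient is \<open>norm h ^ 2\<close>, which tends to
  0.\<close>

lemma has_derivative_norm_cubed:
  fixes x :: "'a::real_inner"
  shows "((\<lambda>y. norm y ^ 3) has_derivative (\<lambda>h. 3 * norm x * (h \<bullet> x))) (at x)"
proof (cases "x = 0")
  case True
  have "((\<lambda>h::'a. norm h ^ 2) \<longlongrightarrow> norm (0::'a) ^ 2) (at 0)"
    by (rule tendsto_power[OF tendsto_norm[OF tendsto_ident_at]])
  moreover have "norm (norm h ^ 3) / norm h = norm h ^ 2" for h :: 'a
    by (simp add: power2_eq_square power3_eq_cube)
  ultimately have "((\<lambda>h::'a. norm (norm h ^ 3) / norm h) \<longlongrightarrow> 0) (at 0)"
    by (simp only:) simp
  then show ?thesis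
    using True by (simp add: has_derivative_at)
next
  case False
  then show ?thesis
    by (auto intro!: derivative_eq_intros has_derivative_norm
        simp: sgn_div_norm power2_eq_square inner_commute field_simps)
qed

lemma inner_matrix_vector_mult_symmetric:
  fixes b :: "real^'n^'n"
  assumes "transpose b = b"
  shows "x \<bullet> (b *v y) = y \<bullet> (b *v x)"
  by (metis assms dot_lmul_matrix inner_commute transpose_matrix_vector)

text \<open>The quadratic term contributes half of
  \<open>s \<bullet> (b *v h) + h \<bullet> (b *v s)\<close> to the derivative; symmetry of
  \<open>b\<close> merges the two summands.\<close>

lemma gradient_cubic_model:
  fixes s :: "real^'n"
  assumes "transpose b = b"
  shows "gradient (cubic_model f x \<sigma> g b) (x + s) = g + b *v s + (\<sigma> * norm s) *\<^sub>R s"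
proof (rule gradient_eqI)
  have cube: "((\<lambda>y. norm (y - x) ^ 3) has_derivative (\<lambda>h. 3 * norm s * (h \<bullet> s))) (at (x + s))"
  proof -
    have "((\<lambda>y. y - x) has_derivative (\<lambda>h. h)) (at (x + s))"
      by (auto intro!: derivative_eq_intros)
    from has_derivative_compose[OF this has_derivative_norm_cubed]
    show ?thesis by simp
  qed
  have mult: "((\<lambda>y. b *v (y - x)) has_derivative (\<lambda>h. b *v h)) (at (x + s))"
    by (rule bounded_linear.has_derivative[OF matrix_vector_mul_bounded_linear])
      (auto intro!: derivative_eq_intros)
  show "GDERIV (cubic_model f x \<sigma> g b) (x + s) :> g + b *v s + (\<sigma> * norm s) *\<^sub>R s"
    unfolding gderiv_def cubic_model_def
    by (rule derivative_eq_intros cube mult refl)+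
      (simp add: fun_eq_iff inner_matrix_vector_mult_symmetric[OF assms, of s] inner_add_right
        algebra_simps)
qed

section \<open>Taylor estimates under a Lipschitz Hessian\<close>

lemma has_derivative_gradient:
  assumes "C2_function f"
  shows "(gradient f has_derivative (*v) (hessian f x)) (at x)"
  using assms unfolding C2_function_def hessian_def by (auto simp: jacobian_works)

text \<open>Mean value inequality for the gradient minus its linearization, on the ball of radius
  \<open>norm s\<close> around \<open>x\<close>. Integration would give
  \<open>L\<^sub>H / 2\<close>; the cruder constant fits into \<open>K\<close>.\<close>

lemma gradient_linearization_error:
  assumes "C2_function f" "\<And>x y. onorm ((*v) (hessian f x - hessian f y)) \<le> L\<^sub>H * norm (x - y)"
    "0 \<le> L\<^sub>H"
  shows "norm (gradient f (x + s) - gradient f x - hessian f x *v s) \<le> L\<^sub>H * norm s ^ 2"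
proof -
  have onorm_bound: "onorm ((*v) (hessian f z) - (*v) (hessian f x)) \<le> L\<^sub>H * norm s"
    if "z \<in> cball x (norm s)" for z
  proof -
    have "(*v) (hessian f z) - (*v) (hessian f x) = (*v) (hessian f z - hessian f x)"
      by (simp add: fun_eq_iff matrix_vector_mult_diff_rdistrib)
    then have "onorm ((*v) (hessian f z) - (*v) (hessian f x)) \<le> L\<^sub>H * norm (z - x)"
      using assms(2)[of z x] by simp
    also have "\<dots> \<le> L\<^sub>H * norm s"
      using that assms(3) by (intro mult_left_mono) (auto simp: dist_norm norm_minus_commute)
    finally show ?thesis .
  qed
  have "norm (gradient f (x + s) - gradient f x - hessian f x *v (x + s - x))
      \<le> norm (x + s - x) * (L\<^sub>H * norm s)"
    by (rule differentiable_bound_linearization[of x "x + s" "cball x (norm s)"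
          "gradient f" "\<lambda>z. (*v) (hessian f z)" x, OF _ _ onorm_bound])
      (auto simp: dist_norm mult_left_le_one_le
        intro: has_derivative_at_withinI has_derivative_gradient assms(1))
  then show ?thesis
    by (simp add: power2_eq_square mult_ac)
qed

lemma second_order_taylor_upper_bound:
  assumes "C2_function f" "\<And>x y. onorm ((*v) (hessian f x - hessian f y)) \<le> L\<^sub>H * norm (x - y)"
    "0 \<le> L\<^sub>H"
  shows "f (x + s) - f x - s \<bullet> gradient f x - 1/2 * (s \<bullet> (hessian f x *v s)) \<le> L\<^sub>H / 3 * norm s ^ 3"
proof -
  \<comment> \<open>The cubic term is chosen so that its derivative
    \<open>t^2 * (L\<^sub>H * norm s ^ 3)\<close> dominates \<open>norm s\<close> times the
    linearization error of the gradient for the step \<open>t *\<^sub>R s\<close>.\<close>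
  define \<psi> where "\<psi> t = f (x + t *\<^sub>R s) - t * (s \<bullet> gradient f x)
    - t^2 / 2 * (s \<bullet> (hessian f x *v s)) - t^3 * (L\<^sub>H / 3 * norm s ^ 3)" for t
  have "\<psi> 1 \<le> \<psi> 0"
  proof (rule DERIV_nonpos_imp_nonincreasing[of 0 1 \<psi>])
    fix t :: real assume t: "0 \<le> t" "t \<le> 1"
    define D where "D = s \<bullet> (gradient f (x + t *\<^sub>R s) - gradient f x - hessian f x *v (t *\<^sub>R s))
      - t^2 * (L\<^sub>H * norm s ^ 3)"
    have "(f has_derivative (\<lambda>h. h \<bullet> gradient f (x + t *\<^sub>R s))) (at (x + t *\<^sub>R s))"
      using GDERIV_gradient[of f] assms(1) unfolding C2_function_def gderiv_def by blast
    moreover have "((\<lambda>t. x + t *\<^sub>R s) has_derivative (\<lambda>h. h *\<^sub>R s)) (at t)"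
      by (auto intro!: derivative_eq_intros)
    ultimately have "((\<lambda>t. f (x + t *\<^sub>R s)) has_derivative
        (\<lambda>h. (h *\<^sub>R s) \<bullet> gradient f (x + t *\<^sub>R s))) (at t)"
      using has_derivative_compose by fastforce
    then have "((\<lambda>t. f (x + t *\<^sub>R s)) has_real_derivative s \<bullet> gradient f (x + t *\<^sub>R s)) (at t)"
      by (simp add: has_field_derivative_def mult_commute_abs)
    then have "DERIV \<psi> t :> D"
      unfolding \<psi>_def D_def
      by (auto intro!: derivative_eq_intros
          simp: inner_diff_right matrix_vector_mult_scaleR algebra_simps)
    moreover have "D \<le> 0"
    proof -
      have "s \<bullet> (gradient f (x + t *\<^sub>R s) - gradient f x - hessian f x *v (t *\<^sub>R s))
          \<le> norm s * norm (gradient f (x + t *\<^sub>R s) - gradient f x - hessian f x *v (t *\<^sub>R s))"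
        by (rule norm_cauchy_schwarz)
      also have "\<dots> \<le> norm s * (L\<^sub>H * norm (t *\<^sub>R s) ^ 2)"
        by (intro mult_left_mono gradient_linearization_error assms) auto
      finally show ?thesis
        by (simp add: D_def power_mult_distrib power2_eq_square power3_eq_cube mult_ac)
    qed
    ultimately show "\<exists>y. DERIV \<psi> t :> y \<and> y \<le> 0" by blast
  qed simp
  then show ?thesis
    by (simp add: \<psi>_def)
qed

section \<open>A single run of the algorithm\<close>

text \<open>Eliminating \<open>s \<bullet> g\<close> by the first step condition, the predicted
  decrease is half of \<open>s \<bullet> (b *v s) + \<sigma> * norm s ^ 3\<close>, nonnegative by
  the second condition, plus \<open>\<sigma> / 6 * norm s ^ 3\<close>.\<close>

lemma predicted_decrease:
  assumes "trial_step f \<kappa>\<theta> x \<sigma> g b s"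
  shows "\<sigma> / 6 * norm s ^ 3 \<le> f x - cubic_model f x \<sigma> g b (x + s)"
  using assms unfolding trial_step_def cubic_model_def by (simp add: field_simps)

lemma successful_decrease:
  assumes "trial_step f \<kappa>\<theta> x \<sigma> g b s" "successful f \<theta> x \<sigma> g b s" "0 < \<sigma>" "0 < \<theta>"
  shows "\<theta> * \<sigma> / 6 * norm s ^ 3 \<le> f x - f (x + s)"
proof (cases "f x - cubic_model f x \<sigma> g b (x + s) = 0")
  \<comment> \<open>The ratio has its default value 1 here, so the acceptance test carries no
    information; the vanishing predicted decrease forces \<open>s = 0\<close> instead.\<close>
  case True
  then have "\<sigma> / 6 * norm s ^ 3 \<le> 0"
    using predicted_decrease[OF assms(1)] by simp
  then have "s = 0"
    using assms(3) by (simp add: mult_le_0_iff)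
  then show ?thesis by simp
next
  case False
  let ?d = "f x - cubic_model f x \<sigma> g b (x + s)"
  have d: "\<sigma> / 6 * norm s ^ 3 \<le> ?d"
    by (rule predicted_decrease[OF assms(1)])
  moreover have "0 \<le> \<sigma> / 6 * norm s ^ 3"
    using assms(3) by simp
  ultimately have "0 < ?d"
    using False by linarith
  then have "\<theta> * ?d \<le> f x - f (x + s)"
    using assms(2) False by (simp add: successful_def decrease_ratio_def pos_le_divide_eq)
  moreover have "\<theta> * (\<sigma> / 6 * norm s ^ 3) \<le> \<theta> * ?d"
    using d assms(4) by (intro mult_left_mono) auto
  ultimately show ?thesis by simp
qed

text \<open>Only deterministic data, so that the results apply to each path separately.
  \<open>\<sigma>min_less\<close> is \<open>C < \<gamma> / \<sigma>min\<close> in terms of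
  reciprocals.\<close>

locale arc_setting =
  fixes f :: "real^'n \<Rightarrow> real"
    and fstar L L\<^sub>H \<gamma> \<theta> \<sigma>min \<kappa>\<theta> \<kappa>g \<kappa>H \<epsilon> :: real
  assumes f_C2: "C2_function f"
    and f_bounded_below: "\<And>x. fstar \<le> f x"
    and L_pos: "L > 0" and L\<^sub>H_pos: "L\<^sub>H > 0"
    and gradient_Lipschitz: "\<And>x y. norm (gradient f x - gradient f y) \<le> L * norm (x - y)"
    and hessian_Lipschitz: "\<And>x y. onorm ((*v) (hessian f x - hessian f y)) \<le> L\<^sub>H * norm (x - y)"
    and \<gamma>: "0 < \<gamma>" "\<gamma> < 1"
    and \<theta>: "0 < \<theta>" "\<theta> < 1"
    and \<kappa>\<theta>: "0 < \<kappa>\<theta>" "\<kappa>\<theta> < 1"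
    and \<sigma>min_pos: "0 < \<sigma>min"
    and K_pos: "0 < 2 * \<kappa>g + \<kappa>H + L + L\<^sub>H"
    and \<sigma>min_less: "\<sigma>min < \<gamma> * ((2 * \<kappa>g + \<kappa>H + L + L\<^sub>H) / (1 - \<theta> / 3))"
    and \<epsilon>: "0 < \<epsilon>"
begin

definition K where "K = 2 * \<kappa>g + \<kappa>H + L + L\<^sub>H"

definition \<sigma>C where "\<sigma>C = K / (1 - \<theta> / 3)"

text \<open>\<open>\<sigma>C\<close> is \<open>1 / C\<close>, and \<open>h\<close> is the decrease \<open>h(C)\<close> guaranteed at this value.\<close>

definition h where
  "h = \<theta> / 6 * \<sigma>min * ((1 - \<kappa>\<theta>) * \<epsilon> / (2 * \<sigma>C)) powr (3/2)"

lemma K_less_\<sigma>C: "0 < K" "K \<le> \<sigma>C"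
  using K_pos \<theta> unfolding K_def \<sigma>C_def by (auto simp: pos_le_divide_eq intro: mult_left_le)

lemma \<sigma>C_pos: "0 < \<sigma>C"
  using K_less_\<sigma>C by linarith

lemma \<sigma>min_less_\<gamma>_\<sigma>C: "\<sigma>min < \<gamma> * \<sigma>C"
  using \<sigma>min_less by (simp add: \<sigma>C_def K_def)

lemma h_pos: "0 < h"
  using \<theta> \<sigma>min_pos \<kappa>\<theta> \<epsilon> \<sigma>C_pos by (simp add: h_def)

section \<open>Accurate iterations: success and sufficient decrease\<close>

text \<open>By Taylor's bound and accuracy, \<open>f\<close> exceeds the model at
  \<open>x + s\<close> by at most a multiple of \<open>norm s ^ 3\<close>. From
  \<open>\<sigma>C\<close> on this is at most \<open>1 - \<theta>\<close> times the predicted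
  decrease, which means a ratio of at least \<open>\<theta>\<close>.\<close>

lemma successful_if_accurate:
  assumes ts: "trial_step f \<kappa>\<theta> x \<sigma> g b s"
    and acc: "accurate_model f \<kappa>g \<kappa>H x g b s"
    and "\<sigma>C \<le> \<sigma>"
  shows "successful f \<theta> x \<sigma> g b s"
proof (cases "f x - cubic_model f x \<sigma> g b (x + s) = 0")
  case True
  then show ?thesis
    using \<theta> by (simp add: successful_def decrease_ratio_def)
next
  case False
  have "0 < \<sigma>"
    using assms(3) \<sigma>C_pos by linarith
  let ?d = "f x - cubic_model f x \<sigma> g b (x + s)"
  have d: "\<sigma> / 6 * norm s ^ 3 \<le> ?d"
    by (rule predicted_decrease[OF ts])
  moreover have "0 \<le> \<sigma> / 6 * norm s ^ 3"
    using \<open>0 < \<sigma>\<close> by simp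
  ultimately have "0 < ?d"
    using False by linarith
  have "s \<bullet> (gradient f x - g) \<le> norm s * (\<kappa>g * (norm s)\<^sup>2)"
    using acc unfolding accurate_model_def
    by (meson mult_left_mono norm_cauchy_schwarz norm_ge_zero order_trans)
  then have g: "s \<bullet> gradient f x - s \<bullet> g \<le> \<kappa>g * norm s ^ 3"
    by (simp add: inner_diff_right power2_eq_square power3_eq_cube mult_ac)
  have "s \<bullet> ((hessian f x - b) *v s) \<le> norm s * (\<kappa>H * (norm s)\<^sup>2)"
    using acc unfolding accurate_model_def
    by (meson mult_left_mono norm_cauchy_schwarz norm_ge_zero order_trans)
  then have H: "s \<bullet> (hessian f x *v s) - s \<bullet> (b *v s) \<le> \<kappa>H * norm s ^ 3"
    by (simp add: inner_diff_right matrix_vector_mult_diff_rdistrib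
        power2_eq_square power3_eq_cube mult_ac)
  have "(1 - \<theta> / 3) * \<sigma>C = K"
    using \<theta> by (simp add: \<sigma>C_def)
  moreover have "(1 - \<theta> / 3) * \<sigma>C \<le> (1 - \<theta> / 3) * \<sigma>"
    using \<theta> assms(3) by (intro mult_left_mono) auto
  \<comment> \<open>Here \<open>\<sigma> / 3 + (1 - \<theta>) * \<sigma> / 6 = (1 - \<theta> / 3) *
    \<sigma> / 2\<close>, which is at least \<open>K / 2\<close>.\<close>
  ultimately have "\<kappa>g + \<kappa>H / 2 + L\<^sub>H / 3 - \<sigma> / 3 \<le> (1 - \<theta>) * (\<sigma> / 6)"
    using L_pos L\<^sub>H_pos by (simp add: K_def algebra_simps)
  then have "(\<kappa>g + \<kappa>H / 2 + L\<^sub>H / 3 - \<sigma> / 3) * norm s ^ 3 \<le> (1 - \<theta>) * (\<sigma> / 6) * norm s ^ 3"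
    by (rule mult_right_mono) simp
  also have "\<dots> \<le> (1 - \<theta>) * ?d"
    using d \<theta> by (metis diff_ge_0_iff_ge less_imp_le mult.assoc mult_left_mono)
  finally have "f (x + s) - cubic_model f x \<sigma> g b (x + s) \<le> (1 - \<theta>) * ?d"
    using g H second_order_taylor_upper_bound[OF f_C2 hessian_Lipschitz, of x s] L\<^sub>H_pos
    by (simp add: cubic_model_def algebra_simps)
  then have "\<theta> * ?d \<le> f x - f (x + s)"
    by (simp add: algebra_simps)
  then show ?thesis
    using False \<open>0 < ?d\<close> by (simp add: successful_def decrease_ratio_def pos_le_divide_eq)
qed

text \<open>The gradient at \<open>x + s\<close> is the model gradient plus errors of order
  \<open>norm s ^ 2\<close>. The model gradient is small relative to \<open>norm g\<close>, which in
  turn is bounded by the new gradient and such errors; absorbing the new gradient on the left leaves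
  the factor \<open>1 - \<kappa>\<theta>\<close>.\<close>

lemma accurate_step_length:
  assumes "transpose b = b"
    and ts: "trial_step f \<kappa>\<theta> x \<sigma> g b s"
    and acc: "accurate_model f \<kappa>g \<kappa>H x g b s"
    and "0 < \<sigma>"
  shows "(1 - \<kappa>\<theta>) * norm (gradient f (x + s)) \<le> (K + \<sigma>) * norm s ^ 2"
proof -
  let ?n2 = "norm s ^ 2"
  define w where "w = gradient (cubic_model f x \<sigma> g b) (x + s)"
  have w: "w = g + b *v s + (\<sigma> * norm s) *\<^sub>R s"
    unfolding w_def by (rule gradient_cubic_model) fact
  have g: "norm (gradient f x - g) \<le> \<kappa>g * ?n2" and H: "norm ((hessian f x - b) *v s) \<le> \<kappa>H * ?n2"
    using acc by (auto simp: accurate_model_def)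
  have g': "norm g \<le> norm (gradient f x - g) + L * norm s + norm (gradient f (x + s))"
  proof -
    have "norm g = norm ((gradient f x - gradient f (x + s)) + gradient f (x + s) - (gradient f x - g))"
      by simp
    also have "\<dots> \<le> norm (gradient f x - gradient f (x + s)) + norm (gradient f (x + s))
        + norm (gradient f x - g)"
      by (meson add_right_mono norm_triangle_ineq norm_triangle_ineq4 order_trans)
    finally show ?thesis
      using gradient_Lipschitz[of x "x + s"] by simp
  qed
  have "norm w \<le> \<kappa>\<theta> * (min 1 (norm s) * norm g)"
    using ts by (simp add: trial_step_def w_def mult.assoc)
  \<comment> \<open>The minimum is bounded by \<open>norm s\<close> in the Lipschitz term, to make
    it quadratic, and by 1 in the other two.\<close>
  also have "min 1 (norm s) * norm g
      \<le> 1 * norm (gradient f x - g) + norm s * (L * norm s) + 1 * norm (gradient f (x + s))"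
  proof -
    have "min 1 (norm s) * norm g \<le> min 1 (norm s) *
        (norm (gradient f x - g) + L * norm s + norm (gradient f (x + s)))"
      using g' by (intro mult_left_mono) auto
    also have "\<dots> \<le> 1 * norm (gradient f x - g) + norm s * (L * norm s)
        + 1 * norm (gradient f (x + s))"
      unfolding distrib_left using L_pos by (intro add_mono mult_right_mono) auto
    finally show ?thesis .
  qed
  also have "\<dots> \<le> \<kappa>g * ?n2 + L * ?n2 + norm (gradient f (x + s))"
    using g by (simp add: power2_eq_square mult_ac)
  finally have "norm w \<le> \<kappa>\<theta> * (\<kappa>g * ?n2 + L * ?n2 + norm (gradient f (x + s)))"
    using \<kappa>\<theta> by simp
  \<comment> \<open>Nonnegativity of \<open>\<kappa>g * norm s ^ 2\<close> comes from accuracy,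
    where it bounds a norm.\<close>
  moreover have "\<kappa>\<theta> * (\<kappa>g * ?n2 + L * ?n2) \<le> 1 * (\<kappa>g * ?n2 + L * ?n2)"
    using \<kappa>\<theta> L_pos order_trans[OF norm_ge_zero g] by (intro mult_right_mono) auto
  moreover have "norm (gradient f (x + s)) \<le>
      norm w + norm (gradient f (x + s) - gradient f x - hessian f x *v s)
      + norm (gradient f x - g) + norm ((hessian f x - b) *v s) + norm ((\<sigma> * norm s) *\<^sub>R s)"
  proof -
    have "gradient f (x + s) = w + (gradient f (x + s) - gradient f x - hessian f x *v s)
      + (gradient f x - g) + (hessian f x - b) *v s - (\<sigma> * norm s) *\<^sub>R s"
      by (simp add: w matrix_vector_mult_diff_rdistrib)
    then show ?thesis
      by (smt (verit) norm_triangle_ineq norm_triangle_ineq4)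
  qed
  moreover have "norm ((\<sigma> * norm s) *\<^sub>R s) = \<sigma> * ?n2"
    using \<open>0 < \<sigma>\<close> by (simp add: power2_eq_square)
  moreover have "norm (gradient f (x + s) - gradient f x - hessian f x *v s) \<le> L\<^sub>H * ?n2"
    using L\<^sub>H_pos by (intro gradient_linearization_error f_C2 hessian_Lipschitz) auto
  ultimately show ?thesis
    using g H by (simp add: K_def algebra_simps)
qed

text \<open>The regularization parameter itself, rather than its lower bound \<open>\<sigma>min\<close>, appears on the
  right. This extends the guaranteed decrease beyond \<open>\<sigma> \<le> \<sigma>C\<close>, which is needed since the
  values of \<open>\<sigma>\<close> leave the lattice \<open>\<sigma>C * \<gamma> ^ j\<close> after being cut off at \<open>\<sigma>min\<close>.\<close>

lemma \<sigma>min_le_weighted: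
  assumes "\<sigma>min \<le> \<sigma>" "\<gamma> * \<sigma> < \<sigma>C"
  shows "\<sigma>min \<le> \<sigma> * (2 * \<sigma>C / (K + \<sigma>)) powr (3/2)"
proof (cases "\<sigma> \<le> \<sigma>C")
  case True
  then have "1 \<le> 2 * \<sigma>C / (K + \<sigma>)"
    using K_less_\<sigma>C assms(1) \<sigma>min_pos by (simp add: pos_le_divide_eq)
  then have "1 \<le> (2 * \<sigma>C / (K + \<sigma>)) powr (3/2)"
    by (simp add: ge_one_powr_ge_zero)
  then have "\<sigma> * 1 \<le> \<sigma> * (2 * \<sigma>C / (K + \<sigma>)) powr (3/2)"
    using assms \<sigma>min_pos by (intro mult_left_mono) auto
  then show ?thesis using assms by simp
next
  case False
  then have \<sigma>: "0 < \<sigma>" "\<sigma>C < \<sigma>"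
    using \<sigma>C_pos by auto
  \<comment> \<open>Since \<open>\<sigma>\<close> exceeds \<open>\<sigma>C\<close> by a factor below
    \<open>1 / \<gamma>\<close>, the gap \<open>\<sigma>min < \<gamma> * \<sigma>C\<close> pays for
    the smaller weight. The exponent 2 may be lowered to 3/2 because
    \<open>\<sigma>C / \<sigma> < 1\<close>.\<close>
  have "\<sigma>min \<le> \<gamma> * \<sigma>C"
    using \<sigma>min_less_\<gamma>_\<sigma>C by simp
  also have "\<dots> \<le> \<sigma> * (\<sigma>C / \<sigma>) ^ 2"
    using assms(2) \<sigma> \<sigma>C_pos by (simp add: power2_eq_square pos_le_divide_eq mult_ac)
  also have "(\<sigma>C / \<sigma>) ^ 2 = (\<sigma>C / \<sigma>) powr 2"
    using \<sigma> \<sigma>C_pos by simp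
  also have "\<sigma> * \<dots> \<le> \<sigma> * (\<sigma>C / \<sigma>) powr (3/2)"
    using \<sigma> \<sigma>C_pos by (intro mult_left_mono powr_mono') auto
  also have "\<dots> \<le> \<sigma> * (2 * \<sigma>C / (K + \<sigma>)) powr (3/2)"
    using \<sigma> \<sigma>C_pos K_less_\<sigma>C
    by (intro mult_left_mono powr_mono2) (auto simp: field_simps)
  finally show ?thesis .
qed

text \<open>The step length bound, raised to the power 3/2, enters the decrease of a successful
  step; \<open>\<sigma>min_le_weighted\<close> removes the dependence on
  \<open>\<sigma>\<close>.\<close>

lemma accurate_decrease:
  assumes sym: "transpose b = b"
    and ts: "trial_step f \<kappa>\<theta> x \<sigma> g b s"
    and acc: "accurate_model f \<kappa>g \<kappa>H x g b s"
    and succ: "successful f \<theta> x \<sigma> g b s"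
    and \<sigma>: "\<sigma>min \<le> \<sigma>" "\<gamma> * \<sigma> < \<sigma>C"
    and grad: "\<epsilon> < norm (gradient f (x + s))"
  shows "h \<le> f x - f (x + s)"
proof -
  have "0 < \<sigma>" "0 < K + \<sigma>"
    using \<sigma> \<sigma>min_pos K_less_\<sigma>C by auto
  define w where "w = (1 - \<kappa>\<theta>) * \<epsilon> / (2 * \<sigma>C)"
  have "0 < w"
    using \<kappa>\<theta> \<epsilon> \<sigma>C_pos by (simp add: w_def)
  have "(1 - \<kappa>\<theta>) * \<epsilon> \<le> (1 - \<kappa>\<theta>) * norm (gradient f (x + s))"
    using grad \<kappa>\<theta> by (intro mult_left_mono) auto
  also have "\<dots> \<le> (K + \<sigma>) * norm s ^ 2"
    by (rule accurate_step_length) fact+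
  finally have s: "2 * \<sigma>C / (K + \<sigma>) * w \<le> norm s ^ 2"
    using \<open>0 < K + \<sigma>\<close> \<sigma>C_pos by (simp add: w_def pos_divide_le_eq mult_ac)
  have "s \<noteq> 0"
    using s \<open>0 < w\<close> \<open>0 < K + \<sigma>\<close> \<sigma>C_pos
    by (metis divide_pos_pos mult_pos_pos norm_zero not_less power_zero_numeral zero_less_numeral)
  have "\<sigma>min * w powr (3/2) \<le> \<sigma> * (2 * \<sigma>C / (K + \<sigma>)) powr (3/2) * w powr (3/2)"
    using \<sigma>min_le_weighted[OF \<sigma>] by (rule mult_right_mono) simp
  also have "\<dots> = \<sigma> * (2 * \<sigma>C / (K + \<sigma>) * w) powr (3/2)"
    using \<open>0 < w\<close> \<open>0 < K + \<sigma>\<close> \<sigma>C_pos by (subst powr_mult) auto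
  also have "\<dots> \<le> \<sigma> * (norm s ^ 2) powr (3/2)"
    using s \<open>0 < w\<close> \<open>0 < K + \<sigma>\<close> \<open>0 < \<sigma>\<close> \<sigma>C_pos by (intro mult_left_mono powr_mono2) auto
  also have "(norm s ^ 2) powr (3/2) = (norm s powr real 2) powr (3/2)"
    using \<open>s \<noteq> 0\<close> by (subst powr_realpow) auto
  also have "\<dots> = norm s powr real 3"
    by (simp only: powr_powr) simp
  also have "\<dots> = norm s ^ 3"
    using \<open>s \<noteq> 0\<close> by (subst powr_realpow) auto
  finally have "\<theta> / 6 * (\<sigma>min * w powr (3/2)) \<le> \<theta> / 6 * (\<sigma> * norm s ^ 3)"
    using \<theta> by (intro mult_left_mono) auto
  then have "h \<le> \<theta> * \<sigma> / 6 * norm s ^ 3"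
    unfolding h_def w_def[symmetric] by (simp only: times_divide_eq_left times_divide_eq_right mult_ac)
  then show ?thesis
    using successful_decrease[OF ts succ \<open>0 < \<sigma>\<close> \<theta>(1)] by linarith
qed

section \<open>Levels of the regularization parameter\<close>

text \<open>The least integer \<open>j\<close> such that multiplying \<open>\<sigma>\<close> by
  \<open>(1 / \<gamma>) ^ j\<close> reaches \<open>\<sigma>C\<close>. Rounding keeps it integral off
  the lattice, so that moves towards 0 never overshoot.\<close>

definition level :: "real \<Rightarrow> int" where
  "level \<sigma> = \<lceil>log (1 / \<gamma>) (\<sigma>C / \<sigma>)\<rceil>"

lemma log_mult_inverse_\<gamma>: "0 < \<sigma> \<Longrightarrow> log (1 / \<gamma>) (\<sigma>C / (\<gamma> * \<sigma>)) = log (1 / \<gamma>) (\<sigma>C / \<sigma>) + 1"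
proof -
  assume "0 < \<sigma>"
  then have "\<sigma>C / (\<gamma> * \<sigma>) = \<sigma>C / \<sigma> * (1 / \<gamma>)"
    by simp
  then show ?thesis
    using \<open>0 < \<sigma>\<close> \<gamma> \<sigma>C_pos by (simp only: log_mult_pos divide_pos_pos zero_less_one) simp
qed

lemma level_mult_\<gamma>: "0 < \<sigma> \<Longrightarrow> level (\<gamma> * \<sigma>) = level \<sigma> + 1"
  by (simp only: level_def log_mult_inverse_\<gamma>) simp

lemma level_divide_\<gamma>: "0 < \<sigma> \<Longrightarrow> level (\<sigma> / \<gamma>) = level \<sigma> - 1"
  using level_mult_\<gamma>[of "\<sigma> / \<gamma>"] \<gamma> by simp

lemma level_antimono: "0 < \<sigma> \<Longrightarrow> \<sigma> \<le> \<tau> \<Longrightarrow> level \<tau> \<le> level \<sigma>"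
  unfolding level_def using \<gamma> \<sigma>C_pos by (intro ceiling_mono) (simp add: divide_left_mono)

lemma level_\<sigma>C: "level \<sigma>C = 0"
  using \<sigma>C_pos by (simp add: level_def)

lemma \<sigma>C_le_if_level: "0 < \<sigma> \<Longrightarrow> level \<sigma> \<le> 0 \<Longrightarrow> \<sigma>C \<le> \<sigma>"
  unfolding level_def using \<gamma> \<sigma>C_pos by (simp add: ceiling_le_iff)

text \<open>Level 0 admits values above \<open>\<sigma>C\<close>, but only by a factor below
  \<open>1 / \<gamma>\<close>, as \<open>accurate_decrease\<close> requires.\<close>

lemma \<gamma>_\<sigma>_less_\<sigma>C_if_level:
  assumes "0 < \<sigma>" "0 \<le> level \<sigma>"
  shows "\<gamma> * \<sigma> < \<sigma>C"
proof (rule ccontr)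
  assume "\<not> \<gamma> * \<sigma> < \<sigma>C"
  then have "level (\<gamma> * \<sigma>) \<le> 0"
    using level_antimono[OF \<sigma>C_pos, of "\<gamma> * \<sigma>"] level_\<sigma>C by simp
  then show False
    using level_mult_\<gamma>[OF assms(1)] assms(2) by simp
qed

text \<open>The cut-off at \<open>\<sigma>min\<close> can only dampen the rise of the level. At
  levels \<open>\<le> 0\<close> it is inactive, as then
  \<open>\<gamma> * \<sigma> \<ge> \<gamma> * \<sigma>C > \<sigma>min\<close>.\<close>

lemma level_success:
  assumes "\<sigma>min \<le> \<sigma>"
  shows "level \<sigma> \<le> level (max (\<gamma> * \<sigma>) \<sigma>min)" "level (max (\<gamma> * \<sigma>) \<sigma>min) \<le> level \<sigma> + 1"
    "level \<sigma> \<le> 0 \<Longrightarrow> level (max (\<gamma> * \<sigma>) \<sigma>min) = level \<sigma> + 1"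
proof -
  have "0 < \<sigma>" "0 < max (\<gamma> * \<sigma>) \<sigma>min" "max (\<gamma> * \<sigma>) \<sigma>min \<le> \<sigma>"
    using assms \<sigma>min_pos \<gamma> by (auto simp: mult_left_le_one_le)
  then show "level \<sigma> \<le> level (max (\<gamma> * \<sigma>) \<sigma>min)"
    by (intro level_antimono)
  show "level (max (\<gamma> * \<sigma>) \<sigma>min) \<le> level \<sigma> + 1"
    using \<open>0 < \<sigma>\<close> \<gamma> by (subst level_mult_\<gamma>[symmetric]) (auto intro: level_antimono)
  assume "level \<sigma> \<le> 0"
  then have "\<gamma> * \<sigma>C \<le> \<gamma> * \<sigma>"
    using \<sigma>C_le_if_level \<open>0 < \<sigma>\<close> \<gamma> by simp
  then show "level (max (\<gamma> * \<sigma>) \<sigma>min) = level \<sigma> + 1"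
    using \<sigma>min_less_\<gamma>_\<sigma>C level_mult_\<gamma>[OF \<open>0 < \<sigma>\<close>] by (simp add: max_def)
qed

section \<open>The potential and its drift along a run\<close>

text \<open>With the factor 2, a decrease of \<open>f\<close> by \<open>h\<close> pays for a level
  rise of 1 and still leaves a drop of 1.\<close>

definition \<Psi> :: "real^'n \<Rightarrow> real \<Rightarrow> real" where
  "\<Psi> x \<sigma> = 2 * (f x - fstar) / h + \<bar>level \<sigma>\<bar>"

lemma \<Psi>_nonneg: "0 \<le> \<Psi> x \<sigma>"
  using f_bounded_below[of x] h_pos by (simp add: \<Psi>_def)

text \<open>Stated with \<open>x + s\<close> rather than the next iterate, so that stopping depends
  on the data of the current iteration alone.\<close>

definition stopped where
  "stopped x \<sigma> g b s \<longleftrightarrow> successful f \<theta> x \<sigma> g b s \<and> norm (gradient f (x + s)) \<le> \<epsilon>"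

lemma \<Psi>_unsuccessful:
  assumes "0 < \<sigma>"
  shows "\<Psi> x (\<sigma> / \<gamma>) \<le> \<Psi> x \<sigma> + 1" "0 < level \<sigma> \<Longrightarrow> \<Psi> x (\<sigma> / \<gamma>) \<le> \<Psi> x \<sigma> - 1"
  using assms by (auto simp: \<Psi>_def level_divide_\<gamma>)

lemma \<Psi>_successful:
  assumes "\<sigma>min \<le> \<sigma>" "f y \<le> f x"
  shows "\<Psi> y (max (\<gamma> * \<sigma>) \<sigma>min) \<le> \<Psi> x \<sigma> + 1"
    and "level \<sigma> < 0 \<Longrightarrow> \<Psi> y (max (\<gamma> * \<sigma>) \<sigma>min) \<le> \<Psi> x \<sigma> - 1"
    and "h \<le> f x - f y \<Longrightarrow> \<Psi> y (max (\<gamma> * \<sigma>) \<sigma>min) \<le> \<Psi> x \<sigma> - 1"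
proof -
  let ?n' = "level (max (\<gamma> * \<sigma>) \<sigma>min)"
  have f: "2 * (f y - fstar) / h \<le> 2 * (f x - fstar) / h"
    using assms(2) h_pos by (intro divide_right_mono) auto
  have abs: "\<bar>?n'\<bar> \<le> \<bar>level \<sigma>\<bar> + 1"
    using level_success[OF assms(1)] by linarith
  then show "\<Psi> y (max (\<gamma> * \<sigma>) \<sigma>min) \<le> \<Psi> x \<sigma> + 1"
    using f unfolding \<Psi>_def by linarith
  show "\<Psi> y (max (\<gamma> * \<sigma>) \<sigma>min) \<le> \<Psi> x \<sigma> - 1" if "level \<sigma> < 0"
  proof -
    have "\<bar>?n'\<bar> \<le> \<bar>level \<sigma>\<bar> - 1"
      using level_success(3)[OF assms(1)] that by linarith
    then show ?thesis
      using f unfolding \<Psi>_def by linarith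
  qed
  show "\<Psi> y (max (\<gamma> * \<sigma>) \<sigma>min) \<le> \<Psi> x \<sigma> - 1" if "h \<le> f x - f y"
  proof -
    have "2 * (f y - fstar + h) / h \<le> 2 * (f x - fstar) / h"
      using that h_pos by (intro divide_right_mono) auto
    then have "2 * (f y - fstar) / h + 2 \<le> 2 * (f x - fstar) / h"
      using h_pos by (simp add: add_divide_distrib distrib_left)
    then show ?thesis
      using abs unfolding \<Psi>_def by linarith
  qed
qed

lemma arc_run_\<sigma>:
  assumes "arc_run f \<gamma> \<theta> \<sigma>min \<kappa>\<theta> x0 \<sigma>0 x \<sigma> g b s" "\<sigma>min \<le> \<sigma>0"
  shows "\<sigma>min \<le> \<sigma> k"
proof (induction k)
  case 0
  then show ?case using assms by (simp add: arc_run_def)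
next
  case (Suc k)
  moreover have "\<sigma> k \<le> \<sigma> k / \<gamma>"
    using Suc \<gamma> \<sigma>min_pos by (simp add: pos_le_divide_eq mult_left_le)
  moreover have "\<sigma> (Suc k) = max (\<gamma> * \<sigma> k) \<sigma>min \<or> \<sigma> (Suc k) = \<sigma> k / \<gamma>"
    using assms(1) unfolding arc_run_def by metis
  ultimately show ?case by auto
qed

lemma \<Psi>_step:
  assumes run: "arc_run f \<gamma> \<theta> \<sigma>min \<kappa>\<theta> x0 \<sigma>0 x \<sigma> g b s" "\<sigma>min \<le> \<sigma>0"
    and not_stopped: "\<not> stopped (x k) (\<sigma> k) (g k) (b k) (s k)"
  shows "\<Psi> (x (Suc k)) (\<sigma> (Suc k)) \<le> \<Psi> (x k) (\<sigma> k) -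
    (if accurate_model f \<kappa>g \<kappa>H (x k) (g k) (b k) (s k) then 1 else -1)"
proof -
  have \<sigma>: "\<sigma>min \<le> \<sigma> k" "0 < \<sigma> k"
    using arc_run_\<sigma>[OF run, of k] \<sigma>min_pos by auto
  have sym: "transpose (b k) = b k"
    and ts: "trial_step f \<kappa>\<theta> (x k) (\<sigma> k) (g k) (b k) (s k)"
    using run(1) by (auto simp: arc_run_def)
  show ?thesis
  proof (cases "successful f \<theta> (x k) (\<sigma> k) (g k) (b k) (s k)")
    case True
    then have next_k: "x (Suc k) = x k + s k" "\<sigma> (Suc k) = max (\<gamma> * \<sigma> k) \<sigma>min"
      using run(1) unfolding arc_run_def by metis+
    have "0 \<le> \<theta> * \<sigma> k / 6 * norm (s k) ^ 3"
      using \<theta> \<sigma> by simp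
    then have f: "f (x k + s k) \<le> f (x k)"
      using successful_decrease[OF ts True \<sigma>(2) \<theta>(1)] by linarith
    \<comment> \<open>Since the run does not stop here although the step succeeds, the gradient at
      \<open>x k + s k\<close> exceeds \<open>\<epsilon>\<close>.\<close>
    have "h \<le> f (x k) - f (x k + s k)"
      if "accurate_model f \<kappa>g \<kappa>H (x k) (g k) (b k) (s k)" "\<not> level (\<sigma> k) < 0"
      using accurate_decrease[OF sym ts that(1) True \<sigma>(1)] \<gamma>_\<sigma>_less_\<sigma>C_if_level[OF \<sigma>(2)]
        that(2) not_stopped True by (auto simp: stopped_def)
    then show ?thesis
      unfolding next_k using \<Psi>_successful[OF \<sigma>(1) f] by auto
  next
    case False
    then have next_k: "x (Suc k) = x k" "\<sigma> (Suc k) = \<sigma> k / \<gamma>"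
      using run(1) unfolding arc_run_def by metis+
    \<comment> \<open>Failure despite accuracy means \<open>\<sigma> k < \<sigma>C\<close>, so
      increasing \<open>\<sigma>\<close> moves the level towards 0.\<close>
    have "0 < level (\<sigma> k)" if "accurate_model f \<kappa>g \<kappa>H (x k) (g k) (b k) (s k)"
      using successful_if_accurate[OF ts that] \<sigma>C_le_if_level[OF \<sigma>(2)] False by force
    then show ?thesis
      unfolding next_k using \<Psi>_unsuccessful[OF \<sigma>(2)] by auto
  qed
qed

text \<open>A run stopping at index \<open>N\<close> contributes the iterations \<open>0, \<dots>, N\<close>; the potential need
  not decrease in the last one, hence the additional \<open>1\<close>.\<close>

lemma true_minus_false_iterations_le:
  assumes run: "arc_run f \<gamma> \<theta> \<sigma>min \<kappa>\<theta> x0 \<sigma>0 x \<sigma> g b s" "\<sigma>min \<le> \<sigma>0"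
  defines "active k \<equiv> \<forall>j<k. \<not> stopped (x j) (\<sigma> j) (g j) (b j) (s j)"
  shows "(\<Sum>k<m. of_bool (active k) *
      (if accurate_model f \<kappa>g \<kappa>H (x k) (g k) (b k) (s k) then 1 else -1)) \<le> \<Psi> x0 \<sigma>0 + 1"
    (is "(\<Sum>k<m. ?d k) \<le> _")
proof -
  \<comment> \<open>The induction keeps the sharper bound with the current potential while the run
    is active; after stopping all summands vanish.\<close>
  have "(\<Sum>k<m. ?d k) \<le> \<Psi> x0 \<sigma>0 + 1 \<and>
      (active m \<longrightarrow> (\<Sum>k<m. ?d k) \<le> \<Psi> x0 \<sigma>0 - \<Psi> (x m) (\<sigma> m))"
  proof (induction m)
    case 0
    then show ?case
      using \<Psi>_nonneg[of x0 \<sigma>0] run(1) by (simp add: arc_run_def)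
  next
    case (Suc m)
    have active_Suc: "active (Suc m) \<longleftrightarrow> active m \<and> \<not> stopped (x m) (\<sigma> m) (g m) (b m) (s m)"
      by (auto simp: active_def less_Suc_eq)
    show ?case
    proof (cases "active m")
      case True
      then show ?thesis
        using Suc \<Psi>_nonneg[of "x m" "\<sigma> m"] \<Psi>_step[OF run, of m]
        by (auto simp: active_Suc)
    qed (use Suc in \<open>simp add: active_Suc\<close>)
  qed
  then show ?thesis by blast
qed

end

section \<open>The random process\<close>

lemma borel_measurable_matrix_vector_mult [measurable (raw)]:
  fixes b :: "'w \<Rightarrow> real^'n^'m"
  assumes "b \<in> borel_measurable M" "s \<in> borel_measurable M"
  shows "(\<lambda>\<omega>. b \<omega> *v s \<omega>) \<in> borel_measurable M"
  using assms
  by (rule borel_measurable_continuous_Pair)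
    (unfold matrix_vector_mult_def, intro continuous_intros)

lemma space_model_history [simp]: "space (model_history P X \<Sigma> G B k) = space P"
  unfolding model_history_def by (rule space_measure_of) auto

lemma sets_model_history:
  "sets (model_history P X \<Sigma> G B k) = sigma_sets (space P)
     {(\<lambda>\<omega>. (X j \<omega>, \<Sigma> j \<omega>, G j \<omega>, B j \<omega>)) -` A \<inter> space P | j A. j < k \<and> A \<in> sets borel}"
  unfolding model_history_def by (rule sets_measure_of) auto

lemma sets_model_history_mono:
  "k \<le> l \<Longrightarrow> sets (model_history P X \<Sigma> G B k) \<subseteq> sets (model_history P X \<Sigma> G B l)"
  unfolding sets_model_history by (intro sigma_sets_mono') force

lemma measurable_model_history_mono:
  "k \<le> l \<Longrightarrow> Y \<in> borel_measurable (model_history P X \<Sigma> G B k) \<Longrightarrow>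
    Y \<in> borel_measurable (model_history P X \<Sigma> G B l)"
  by (rule measurable_from_subalg[rotated])
    (auto simp: subalgebra_def intro: sets_model_history_mono[THEN subsetD])

lemma measurable_model_history:
  fixes X G :: "nat \<Rightarrow> 'w \<Rightarrow> real^'n" and B :: "nat \<Rightarrow> 'w \<Rightarrow> real^'n^'n"
  assumes "j < k"
  shows "X j \<in> borel_measurable (model_history P X \<Sigma> G B k)"
    and "\<Sigma> j \<in> borel_measurable (model_history P X \<Sigma> G B k)"
    and "G j \<in> borel_measurable (model_history P X \<Sigma> G B k)"
    and "B j \<in> borel_measurable (model_history P X \<Sigma> G B k)"
proof -
  let ?F = "model_history P X \<Sigma> G B k"
  have "(\<lambda>\<omega>. (X j \<omega>, \<Sigma> j \<omega>, G j \<omega>, B j \<omega>)) \<in> borel_measurable ?F"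
  proof (rule measurableI)
    fix A :: "((real^'n) \<times> real \<times> (real^'n) \<times> (real^'n^'n)) set" assume "A \<in> sets borel"
    then show "(\<lambda>\<omega>. (X j \<omega>, \<Sigma> j \<omega>, G j \<omega>, B j \<omega>)) -` A \<inter> space ?F \<in> sets ?F"
      using assms unfolding sets_model_history space_model_history
      by (intro sigma_sets.Basic) blast
  qed simp
  \<comment> \<open>With \<open>borel\<close> rewritten as a product of Borel algebras, the
    projections are recognized as measurable.\<close>
  note this[folded borel_prod, measurable]
  have "(\<lambda>\<omega>. fst (X j \<omega>, \<Sigma> j \<omega>, G j \<omega>, B j \<omega>)) \<in> borel_measurable ?F"
    "(\<lambda>\<omega>. fst (snd (X j \<omega>, \<Sigma> j \<omega>, G j \<omega>, B j \<omega>))) \<in> borel_measurable ?F"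
    "(\<lambda>\<omega>. fst (snd (snd (X j \<omega>, \<Sigma> j \<omega>, G j \<omega>, B j \<omega>)))) \<in> borel_measurable ?F"
    "(\<lambda>\<omega>. snd (snd (snd (X j \<omega>, \<Sigma> j \<omega>, G j \<omega>, B j \<omega>)))) \<in> borel_measurable ?F"
    by measurable
  then show "X j \<in> borel_measurable ?F" "\<Sigma> j \<in> borel_measurable ?F"
    "G j \<in> borel_measurable ?F" "B j \<in> borel_measurable ?F"
    by simp_all
qed

text \<open>Restricted to indices below \<open>k\<close>, so that it can serve inside the induction
  that proves \<open>X\<close> and \<open>\<Sigma>\<close> measurable.\<close>

lemma subalgebra_model_history:
  assumes "\<And>j. j < k \<Longrightarrow> X j \<in> borel_measurable P" "\<And>j. j < k \<Longrightarrow> \<Sigma> j \<in> borel_measurable P"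
    "\<And>j. j < k \<Longrightarrow> G j \<in> borel_measurable P" "\<And>j. j < k \<Longrightarrow> B j \<in> borel_measurable P"
  shows "subalgebra P (model_history P X \<Sigma> G B k)"
proof -
  have "(\<lambda>\<omega>. (X j \<omega>, \<Sigma> j \<omega>, G j \<omega>, B j \<omega>)) \<in> borel_measurable P" if "j < k" for j
    using assms[OF that] by measurable
  then show ?thesis
    unfolding subalgebra_def sets_model_history space_model_history
    by (auto intro!: sets.sigma_sets_subset dest: measurable_sets)
qed

section \<open>The stopping index as a sum of tail indicators\<close>

lemma enat_less_Inf_iff: "enat t < Inf (enat ` A) \<longleftrightarrow> (\<forall>k<Suc t. k \<notin> A)"
proof -
  have "enat t < Inf (enat ` A) \<longleftrightarrow> (\<forall>k\<in>A. enat (Suc t) \<le> enat k)"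
    unfolding Suc_ile_eq[symmetric] by (rule le_INF_iff)
  then show ?thesis
    by (auto simp: not_less[symmetric])
qed

text \<open>Exactly \<open>n\<close> indices lie below \<open>n\<close>, infinitely many if
  \<open>n\<close> is infinite.\<close>

lemma ennreal_of_enat_eq_suminf: "ennreal_of_enat n = (\<Sum>i. of_bool (enat i < n))"
proof -
  have "(\<lambda>i::nat. if i < n then 1 else 0) sums ennreal_of_enat n"
    using sums_If_finite[of "\<lambda>r. r < n" "\<lambda>_. 1 :: ennreal"]
    by (cases n) (simp_all add: sums_def of_nat_tendsto_top_ennreal)
  then show ?thesis
    by (simp add: sums_iff of_bool_def)
qed

context arc_setting
begin

lemma measurable_f [measurable]: "f \<in> borel_measurable borel"
  using f_C2 unfolding C2_function_def
  by (intro borel_measurable_continuous_onI continuous_at_imp_continuous_on)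
    (auto intro: differentiable_imp_continuous_within)

lemma measurable_gradient [measurable]: "gradient f \<in> borel_measurable borel"
  using f_C2 unfolding C2_function_def
  by (intro borel_measurable_continuous_onI continuous_at_imp_continuous_on)
    (auto intro: differentiable_imp_continuous_within)

lemma measurable_hessian [measurable]: "hessian f \<in> borel_measurable borel"
  using f_C2 unfolding C2_function_def by (intro borel_measurable_continuous_onI) auto

lemma measurable_successful [measurable (raw)]:
  assumes [measurable]: "x \<in> borel_measurable M" "\<sigma> \<in> borel_measurable M"
    "g \<in> borel_measurable M" "b \<in> borel_measurable M" "s \<in> borel_measurable M"
  shows "Measurable.pred M (\<lambda>\<omega>. successful f \<theta> (x \<omega>) (\<sigma> \<omega>) (g \<omega>) (b \<omega>) (s \<omega>))"
  unfolding successful_def decrease_ratio_def cubic_model_def by measurable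

lemma measurable_stopped [measurable (raw)]:
  assumes [measurable]: "x \<in> borel_measurable M" "\<sigma> \<in> borel_measurable M"
    "g \<in> borel_measurable M" "b \<in> borel_measurable M" "s \<in> borel_measurable M"
  shows "Measurable.pred M (\<lambda>\<omega>. stopped (x \<omega>) (\<sigma> \<omega>) (g \<omega>) (b \<omega>) (s \<omega>))"
  unfolding stopped_def by measurable

lemma measurable_accurate_model [measurable (raw)]:
  assumes [measurable]: "x \<in> borel_measurable M"
    "g \<in> borel_measurable M" "b \<in> borel_measurable M" "s \<in> borel_measurable M"
  shows "Measurable.pred M (\<lambda>\<omega>. accurate_model f \<kappa>g \<kappa>H (x \<omega>) (g \<omega>) (b \<omega>) (s \<omega>))"
  unfolding accurate_model_def by measurable

end

section \<open>Active and accurate iterations as random events\<close>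

locale random_arc_setting = arc_setting f fstar L L\<^sub>H \<gamma> \<theta> \<sigma>min \<kappa>\<theta> \<kappa>g \<kappa>H \<epsilon>
  for f :: "real^'n \<Rightarrow> real"
    and fstar L L\<^sub>H \<gamma> \<theta> \<sigma>min \<kappa>\<theta> \<kappa>g \<kappa>H \<epsilon> :: real +
  fixes P :: "'w measure"
    and X G S :: "nat \<Rightarrow> 'w \<Rightarrow> real^'n"
    and \<Sigma> :: "nat \<Rightarrow> 'w \<Rightarrow> real"
    and B :: "nat \<Rightarrow> 'w \<Rightarrow> real^'n^'n"
    and x0 :: "real^'n"
    and \<sigma>0 p :: real
  assumes process: "arc_process P f \<gamma> \<theta> \<sigma>min \<kappa>\<theta> x0 \<sigma>0 X \<Sigma> G B S"
    and accurate: "prob_sufficiently_accurate P f p \<kappa>g \<kappa>H X \<Sigma> G B S"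
    and \<sigma>0: "\<sigma>min \<le> \<sigma>0"
begin

sublocale prob_space P
  using process by (simp add: arc_process_def)

lemma run:
  "\<omega> \<in> space P \<Longrightarrow> arc_run f \<gamma> \<theta> \<sigma>min \<kappa>\<theta> x0 \<sigma>0
    (\<lambda>k. X k \<omega>) (\<lambda>k. \<Sigma> k \<omega>) (\<lambda>k. G k \<omega>) (\<lambda>k. B k \<omega>) (\<lambda>k. S k \<omega>)"
  using process by (simp add: arc_process_def)

lemma measurable_G [measurable]: "G k \<in> borel_measurable P"
  and measurable_B [measurable]: "B k \<in> borel_measurable P"
  and measurable_S_history: "S k \<in> borel_measurable (model_history P X \<Sigma> G B (Suc k))"
  using process by (auto simp: arc_process_def)

abbreviation "success k \<omega> \<equiv> successful f \<theta> (X k \<omega>) (\<Sigma> k \<omega>) (G k \<omega>) (B k \<omega>) (S k \<omega>)"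

text \<open>The update rule passes measurability on, provided that \<open>S n\<close> is measurable
  in \<open>P\<close>. This holds once the history up to \<open>n\<close> is a subalgebra, which
  involves all earlier iterates; hence strong induction.\<close>

lemma measurable_X_\<Sigma>: "X k \<in> borel_measurable P \<and> \<Sigma> k \<in> borel_measurable P"
proof (induction k rule: less_induct)
  case (less k)
  show ?case
  proof (cases k)
    case 0
    have "\<omega> \<in> space P \<Longrightarrow> X 0 \<omega> = x0 \<and> \<Sigma> 0 \<omega> = \<sigma>0" for \<omega>
      using run[of \<omega>] by (simp add: arc_run_def)
    then show ?thesis
      unfolding 0 by (auto cong: measurable_cong)
  next
    case (Suc n)
    then have [measurable]: "X n \<in> borel_measurable P" "\<Sigma> n \<in> borel_measurable P"
      using less by auto
    have "subalgebra P (model_history P X \<Sigma> G B (Suc n))"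
      using less Suc by (intro subalgebra_model_history) auto
    then have [measurable]: "S n \<in> borel_measurable P"
      using measurable_S_history measurable_from_subalg by blast
    have "X (Suc n) \<omega> = (if success n \<omega> then X n \<omega> + S n \<omega> else X n \<omega>)"
      "\<Sigma> (Suc n) \<omega> = (if success n \<omega> then max (\<gamma> * \<Sigma> n \<omega>) \<sigma>min else \<Sigma> n \<omega> / \<gamma>)"
      if "\<omega> \<in> space P" for \<omega>
      using run[OF that] unfolding arc_run_def by metis+
    then show ?thesis
      unfolding Suc by (simp cong: measurable_cong)
  qed
qed

lemma measurable_X [measurable]: "X k \<in> borel_measurable P"
  and measurable_\<Sigma> [measurable]: "\<Sigma> k \<in> borel_measurable P"
  using measurable_X_\<Sigma> by auto

lemma subalgebra_history: "subalgebra P (model_history P X \<Sigma> G B k)"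
  by (rule subalgebra_model_history) measurable

lemma measurable_S [measurable]: "S k \<in> borel_measurable P"
  using subalgebra_history measurable_S_history by (rule measurable_from_subalg)

definition active where
  "active k \<omega> \<longleftrightarrow> (\<forall>j<k. \<not> stopped (X j \<omega>) (\<Sigma> j \<omega>) (G j \<omega>) (B j \<omega>) (S j \<omega>))"

definition Active where "Active k = {\<omega> \<in> space P. active k \<omega>}"

definition Accurate where
  "Accurate k = {\<omega> \<in> space P. accurate_model f \<kappa>g \<kappa>H (X k \<omega>) (G k \<omega>) (B k \<omega>) (S k \<omega>)}"

text \<open>Stopping in an iteration \<open>j < k\<close> is decided by the models up to
  \<open>j\<close> and by \<open>S j\<close>, itself a function of these models.\<close>

lemma Active_in_history: "Active k \<in> sets (model_history P X \<Sigma> G B k)"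
proof -
  let ?F = "model_history P X \<Sigma> G B k"
  have "Measurable.pred ?F (\<lambda>\<omega>. stopped (X j \<omega>) (\<Sigma> j \<omega>) (G j \<omega>) (B j \<omega>) (S j \<omega>))"
    if "j < k" for j
    using that measurable_model_history_mono[OF _ measurable_S_history, of j k]
    by (intro measurable_stopped measurable_model_history) auto
  then have "{\<omega> \<in> space P. stopped (X j \<omega>) (\<Sigma> j \<omega>) (G j \<omega>) (B j \<omega>) (S j \<omega>)} \<in> sets ?F"
    if "j < k" for j
    using that by (simp add: pred_def)
  then have "space ?F - (\<Union>j<k. {\<omega> \<in> space P.
      stopped (X j \<omega>) (\<Sigma> j \<omega>) (G j \<omega>) (B j \<omega>) (S j \<omega>)}) \<in> sets ?F"
    by (intro sets.compl_sets sets.finite_UN) auto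
  also have "space ?F - (\<Union>j<k. {\<omega> \<in> space P.
      stopped (X j \<omega>) (\<Sigma> j \<omega>) (G j \<omega>) (B j \<omega>) (S j \<omega>)}) = Active k"
    by (auto simp: Active_def active_def)
  finally show ?thesis .
qed

lemma Active_sets [measurable, simp]: "Active k \<in> sets P"
  using Active_in_history subalgebra_history by (auto simp: subalgebra_def)

lemma Accurate_sets [measurable, simp]: "Accurate k \<in> sets P"
  unfolding Accurate_def by measurable

text \<open>The bound on the conditional probability is integrated over \<open>Active k\<close>, an
  event of the conditioning algebra.\<close>

lemma prob_Active_Accurate: "p * prob (Active k) \<le> prob (Active k \<inter> Accurate k)"
proof -
  let ?F = "model_history P X \<Sigma> G B k"
  interpret finite_measure_subalgebra P ?F
    by unfold_locales (rule subalgebra_history)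
  have "p * prob (Active k) = (\<integral>\<omega>\<in>Active k. p \<partial>P)"
    by (simp add: set_lebesgue_integral_def mult.commute)
  also have "\<dots> \<le> (\<integral>\<omega>\<in>Active k. real_cond_exp P ?F (indicator (Accurate k)) \<omega> \<partial>P)"
  proof (rule set_integral_mono_AE)
    show "set_integrable P (Active k) (\<lambda>_. p)"
      by (simp add: set_integrable_def less_top[symmetric])
    show "set_integrable P (Active k) (real_cond_exp P ?F (indicator (Accurate k)))"
      unfolding set_integrable_def
      by (intro integrable_mult_indicator real_cond_exp_int)
        (auto simp: less_top[symmetric])
    show "AE \<omega>\<in>Active k in P. p \<le> real_cond_exp P ?F (indicator (Accurate k)) \<omega>"
      using accurate unfolding prob_sufficiently_accurate_def Accurate_def
      by (auto elim!: allE[where x = k] AE_mp)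
  qed
  also have "\<dots> = (\<integral>\<omega>\<in>Active k. indicator (Accurate k) \<omega> \<partial>P)"
    by (rule real_cond_exp_intA[symmetric]) (auto simp: Active_in_history less_top[symmetric])
  also have "\<dots> = prob (Active k \<inter> Accurate k)"
    by (simp add: set_lebesgue_integral_def indicator_inter_arith[symmetric])
  finally show ?thesis .
qed

lemma prob_Active_0: "prob (Active 0) = 1"
  by (simp add: Active_def active_def prob_space)

text \<open>Taken from iteration 0, which is always active.\<close>

lemma p_le_1: "p \<le> 1"
  using prob_Active_Accurate[of 0] prob_Active_0 prob_le_1 order_trans by fastforce

text \<open>The pathwise excess of accurate over inaccurate active iterations is averaged: \<open>2
  * indicator (Active k \<inter> Accurate k) - indicator (Active k)\<close> is 1, -1 or 0 according
  to the three cases.\<close>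

lemma sum_prob_Active_le: "(2 * p - 1) * (\<Sum>k<m. prob (Active k)) \<le> \<Psi> x0 \<sigma>0 + 1"
proof -
  have "(2 * p - 1) * (\<Sum>k<m. prob (Active k))
      \<le> (\<Sum>k<m. 2 * prob (Active k \<inter> Accurate k) - prob (Active k))"
    unfolding sum_distrib_left using prob_Active_Accurate
    by (intro sum_mono) (simp add: algebra_simps)
  also have "\<dots> = (\<integral>\<omega>. (\<Sum>k<m. 2 * indicator (Active k \<inter> Accurate k) \<omega> - indicator (Active k) \<omega>) \<partial>P)"
    by (subst Bochner_Integration.integral_sum) (auto simp: less_top[symmetric])
  also have "\<dots> \<le> (\<integral>\<omega>. \<Psi> x0 \<sigma>0 + 1 \<partial>P)"
  proof (rule integral_mono)
    fix \<omega> assume \<omega>: "\<omega> \<in> space P"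
    have "2 * indicator (Active k \<inter> Accurate k) \<omega> - indicator (Active k) \<omega>
      = of_bool (active k \<omega>) *
        (if accurate_model f \<kappa>g \<kappa>H (X k \<omega>) (G k \<omega>) (B k \<omega>) (S k \<omega>) then 1 else -1 :: real)" for k
      using \<omega> by (auto simp: Active_def Accurate_def)
    then show "(\<Sum>k<m. 2 * indicator (Active k \<inter> Accurate k) \<omega> - indicator (Active k) \<omega>)
        \<le> \<Psi> x0 \<sigma>0 + 1"
      using true_minus_false_iterations_le[OF run[OF \<omega>] \<sigma>0, of m] by (simp add: active_def)
  qed (auto simp: less_top[symmetric])
  finally show ?thesis
    by (simp add: prob_space)
qed

abbreviation "N \<omega> \<equiv> N_eps f \<theta> \<epsilon>
  (\<lambda>k. X k \<omega>) (\<lambda>k. \<Sigma> k \<omega>) (\<lambda>k. G k \<omega>) (\<lambda>k. B k \<omega>) (\<lambda>k. S k \<omega>)"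

text \<open>\<open>t < N\<close> excludes stopping in iterations \<open>0, ..., t\<close>, hence
  \<open>Suc t\<close>. On success the next iterate is \<open>X k + S k\<close>, which identifies
  the event in \<open>N_eps\<close> with \<open>stopped\<close>.\<close>

lemma less_N_iff_active: "\<omega> \<in> space P \<Longrightarrow> enat t < N \<omega> \<longleftrightarrow> active (Suc t) \<omega>"
proof -
  assume "\<omega> \<in> space P"
  then have "success k \<omega> \<Longrightarrow> X (Suc k) \<omega> = X k \<omega> + S k \<omega>" for k
    using run unfolding arc_run_def by metis
  then have "success k \<omega> \<and> norm (gradient f (X (Suc k) \<omega>)) \<le> \<epsilon> \<longleftrightarrow>
      stopped (X k \<omega>) (\<Sigma> k \<omega>) (G k \<omega>) (B k \<omega>) (S k \<omega>)" for k
    unfolding stopped_def by metis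
  then show ?thesis
    by (simp add: N_eps_def enat_less_Inf_iff active_def)
qed

lemma expected_N_le:
  assumes "1/2 < p"
  shows "(\<integral>\<^sup>+\<omega>. ennreal_of_enat (N \<omega>) \<partial>P) \<le> ennreal ((\<Psi> x0 \<sigma>0 + 1) / (2 * p - 1) - 1)"
proof -
  have "(\<integral>\<^sup>+\<omega>. ennreal_of_enat (N \<omega>) \<partial>P) = (\<integral>\<^sup>+\<omega>. (\<Sum>i. indicator (Active (Suc i)) \<omega>) \<partial>P)"
    by (intro nn_integral_cong, unfold ennreal_of_enat_eq_suminf)
      (auto simp: less_N_iff_active Active_def indicator_def of_bool_def intro!: suminf_cong)
  also have "\<dots> = (\<Sum>i. emeasure P (Active (Suc i)))"
    by (subst nn_integral_suminf) auto
  also have "\<dots> \<le> ennreal ((\<Psi> x0 \<sigma>0 + 1) / (2 * p - 1) - 1)"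
    unfolding suminf_eq_SUP
  proof (rule SUP_least)
    fix m
    \<comment> \<open>The tail sum starts at \<open>Active 1\<close>; the missing term
      \<open>prob (Active 0) = 1\<close> is the \<open>- 1\<close> in the bound.\<close>
    have "(\<Sum>i<m. prob (Active (Suc i))) + 1 = (\<Sum>k<Suc m. prob (Active k))"
      by (simp add: sum.lessThan_Suc_shift prob_Active_0 del: sum.lessThan_Suc)
    also have "\<dots> \<le> (\<Psi> x0 \<sigma>0 + 1) / (2 * p - 1)"
      using sum_prob_Active_le[of "Suc m"] assms by (simp add: pos_le_divide_eq mult.commute)
    finally show "(\<Sum>i<m. emeasure P (Active (Suc i))) \<le> ennreal ((\<Psi> x0 \<sigma>0 + 1) / (2 * p - 1) - 1)"
      by (simp add: emeasure_eq_measure sum_ennreal measure_nonneg ennreal_leI)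
  qed
  finally show ?thesis .
qed

end

section \<open>From the drift bound to the stated constants\<close>

text \<open>Applied with \<open>u = 2 * p - 1\<close>. After multiplication by
  \<open>u\<^sup>2\<close>, \<open>u \<le> 1\<close> turns \<open>2 * u * F\<close> into
  \<open>(u + 1) * F\<close>, and \<open>1 \<le> c\<close> absorbs the additional 1.\<close>

lemma drift_bound_le:
  fixes u c F :: real
  assumes "0 < u" "u \<le> 1" "1 \<le> c" "0 \<le> F"
  shows "(2 * F + c + 1) / u - 1 \<le> (u + 1) / u\<^sup>2 * (F + c)"
proof -
  have "u * (2 * F) \<le> (u + 1) * F"
    using assms mult_right_mono[of u 1 F] by (simp add: algebra_simps)
  moreover have "u * 1 \<le> 1 * c"
    using assms by (intro mult_mono) auto
  ultimately have "(2 * F + c + 1) * u - u\<^sup>2 \<le> (u + 1) * (F + c)"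
    using zero_le_power2[of u] by (simp only: algebra_simps)
  then have "((2 * F + c + 1) * u - u\<^sup>2) / u\<^sup>2 \<le> (u + 1) * (F + c) / u\<^sup>2"
    by (intro divide_right_mono) auto
  then show ?thesis
    using assms(1) by (simp add: diff_divide_distrib power2_eq_square)
qed

text \<open>Since \<open>6 * 2 powr (3/2) = 12 * sqrt 2\<close>, the factors before the last are
  \<open>\<kappa>f\<close>; so \<open>(f x0 - fstar) / h\<close> is
  \<open>M / \<epsilon> powr (3/2)\<close>.\<close>

lemma (in arc_setting) h_eq:
  "h = \<theta> / (12 * sqrt 2) * (1 - \<kappa>\<theta>) powr (3/2) * \<sigma>min *
    ((1 - \<theta> / 3) powr (3/2) * \<epsilon> powr (3/2) / K powr (3/2))"
proof -
  have "2 powr (3/2) = 2 powr (1 + 1/2 :: real)"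
    by simp
  also have "\<dots> = 2 * sqrt 2"
    unfolding powr_add by (simp add: powr_half_sqrt)
  finally have "2 powr (3/2) = 2 * sqrt 2" .
  then have "((1 - \<kappa>\<theta>) * \<epsilon> / (2 * \<sigma>C)) powr (3/2) = (1 - \<kappa>\<theta>) powr (3/2) * \<epsilon> powr (3/2)
      / (2 * sqrt 2 * (K powr (3/2) / (1 - \<theta> / 3) powr (3/2)))"
    unfolding \<sigma>C_def using \<kappa>\<theta> \<epsilon> \<theta> K_less_\<sigma>C by (simp add: powr_divide powr_mult)
  then show ?thesis
    unfolding h_def by (simp add: mult_ac)
qed

theorem theorem4p1:
  fixes f :: "real^'n \<Rightarrow> real"
    and fstar L L\<^sub>H \<gamma> \<theta> \<sigma>min \<kappa>\<theta> \<sigma>0 \<kappa>g \<kappa>H p \<epsilon> K \<kappa>f M :: real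
    and x0 :: "real^'n"
    and P :: "'w measure"
    and X G S :: "nat \<Rightarrow> 'w \<Rightarrow> real^'n"
    and \<Sigma> :: "nat \<Rightarrow> 'w \<Rightarrow> real"
    and B :: "nat \<Rightarrow> 'w \<Rightarrow> real^'n^'n"
  defines "K \<equiv> 2 * \<kappa>g + \<kappa>H + L + L\<^sub>H"
    and "\<kappa>f \<equiv> \<theta> / (12 * sqrt 2) * (1 - \<kappa>\<theta>) powr (3/2) * \<sigma>min"
    and "M \<equiv> (f x0 - fstar) * K powr (3/2) / (\<kappa>f * (1 - \<theta> / 3) powr (3/2))"
  assumes f_C2: "C2_function f"
    and f_bounded_below: "\<And>x. fstar \<le> f x"
    and L_pos: "L > 0" and L\<^sub>H_pos: "L\<^sub>H > 0"
    and gradient_Lipschitz: "\<And>x y. norm (gradient f x - gradient f y) \<le> L * norm (x - y)"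
    and hessian_Lipschitz: "\<And>x y. onorm ((*v) (hessian f x - hessian f y)) \<le> L\<^sub>H * norm (x - y)"
    and \<gamma>: "0 < \<gamma>" "\<gamma> < 1"
    and \<theta>: "0 < \<theta>" "\<theta> < 1"
    and \<kappa>\<theta>: "0 < \<kappa>\<theta>" "\<kappa>\<theta> < 1"
    and \<sigma>: "0 < \<sigma>min" "\<sigma>min < \<sigma>0"
    and process: "arc_process P f \<gamma> \<theta> \<sigma>min \<kappa>\<theta> x0 \<sigma>0 X \<Sigma> G B S"
    and accurate: "prob_sufficiently_accurate P f p \<kappa>g \<kappa>H X \<Sigma> G B S"
    and p: "p > 1/2"
    and C: "\<exists>c::nat. c > 0 \<and> (1 - \<theta> / 3) / K = \<gamma> ^ c * (1 / \<sigma>0)"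
           "(1 - \<theta> / 3) / K < \<gamma> * (1 / \<sigma>min)"
    and \<epsilon>: "\<epsilon> > 0"
  shows "(\<integral>\<^sup>+ \<omega>. ennreal_of_enat (N_eps f \<theta> \<epsilon>
            (\<lambda>k. X k \<omega>) (\<lambda>k. \<Sigma> k \<omega>) (\<lambda>k. G k \<omega>) (\<lambda>k. B k \<omega>) (\<lambda>k. S k \<omega>)) \<partial>P)
         \<le> ennreal (2 * p / (2 * p - 1)\<^sup>2 *
              (M / \<epsilon> powr (3/2) + log (1 / \<gamma>) (K / (\<sigma>0 * (1 - \<theta> / 3)))))"
proof -
  obtain c :: nat where c: "0 < c" "(1 - \<theta> / 3) / K = \<gamma> ^ c * (1 / \<sigma>0)"
    using C(1) by blast
  \<comment> \<open>Positivity of \<open>K\<close> follows from the equation for \<open>C\<close>,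
    whatever the signs of \<open>\<kappa>g\<close> and \<open>\<kappa>H\<close>;
    \<open>K = 0\<close> would make the quotient 0.\<close>
  have "0 < (1 - \<theta> / 3) / K"
    unfolding c(2) using \<gamma> \<sigma> by simp
  then have "0 < K"
    using \<theta> by (simp add: zero_less_divide_iff)
  interpret A: random_arc_setting f fstar L L\<^sub>H \<gamma> \<theta> \<sigma>min \<kappa>\<theta> \<kappa>g \<kappa>H \<epsilon> P X G S \<Sigma> B x0 \<sigma>0 p
  proof unfold_locales
    show "0 < 2 * \<kappa>g + \<kappa>H + L + L\<^sub>H"
      using \<open>0 < K\<close> by (simp add: K_def)
    show "\<sigma>min < \<gamma> * ((2 * \<kappa>g + \<kappa>H + L + L\<^sub>H) / (1 - \<theta> / 3))"
      using C(2) \<open>0 < K\<close> \<theta> \<sigma> unfolding K_def[symmetric] by (simp add: field_simps)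
  qed (use assms in auto)
  have K: "A.K = K"
    by (simp add: A.K_def K_def)
  \<comment> \<open>The initial value \<open>\<sigma>0\<close> lies on the lattice, so rounding has
    no effect and the level is the logarithmic term itself.\<close>
  have "K / (\<sigma>0 * (1 - \<theta> / 3)) = (1 / \<gamma>) ^ c"
    using c(2) \<open>0 < K\<close> \<theta> \<sigma> \<gamma> by (simp add: field_simps)
  then have log: "log (1 / \<gamma>) (K / (\<sigma>0 * (1 - \<theta> / 3))) = c"
    using \<gamma> by (simp add: log_nat_power)
  have "A.\<sigma>C / \<sigma>0 = K / (\<sigma>0 * (1 - \<theta> / 3))"
    by (simp add: A.\<sigma>C_def K)
  then have "A.level \<sigma>0 = c"
    by (simp add: A.level_def log)
  moreover have "M / \<epsilon> powr (3/2) = (f x0 - fstar) / A.h"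
    unfolding A.h_eq K M_def \<kappa>f_def by (simp add: mult_ac)
  ultimately have \<Psi>: "A.\<Psi> x0 \<sigma>0 = 2 * (M / \<epsilon> powr (3/2)) + c"
    by (simp add: A.\<Psi>_def)
  have "0 \<le> M / \<epsilon> powr (3/2)"
    using \<open>M / \<epsilon> powr (3/2) = _\<close> f_bounded_below[of x0] A.h_pos by simp
  then have "(A.\<Psi> x0 \<sigma>0 + 1) / (2 * p - 1) - 1
      \<le> (2 * p - 1 + 1) / (2 * p - 1)\<^sup>2 * (M / \<epsilon> powr (3/2) + c)"
    unfolding \<Psi> using p A.p_le_1 c(1) by (intro drift_bound_le) auto
  then show ?thesis
    unfolding log using A.expected_N_le[OF p] by (auto intro: order_trans ennreal_leI)
qed

end
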